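(* For every $0<\epsilon<\frac1e$ there are constants $c(\epsilon)>0$ and $p_0(\epsilon)$ such that for every prime $p\ge p_0(\epsilon)$, every integer $1\le k\le\frac{\log p}{\log\log p}$ and every $A\in\mathscr{A}(p,k)$, the total variation mixing times of $\mu_A$ on $\mathbb{Z}/p\mathbb{Z}$ satisfy $$t_1^{\mathrm{mix}}(\epsilon)-t_1^{\mathrm{mix}}(1-\epsilon)\ge c(\epsilon)\,\frac{t_1^{\mathrm{mix}}}{k}.$$
   Context: For a prime $p$ and integer $k\ge1$, $\mathscr{A}(p,k)$ is the collection of sets $A\subset\mathbb{Z}/p\mathbb{Z}$ with $|A|=2k+1$ that are symmetric ($x\in A\iff-x\in A$) and lazy ($0\in A$). $\mu_A$ is the uniform probability measure on $A$, $\mu_A^{*n}$ its $n$-fold convolution power, and $\mathbb{U}$ the uniform measure on $\mathbb{Z}/p\mathbb{Z}$. $\|\mu-\nu\|_{\mathrm{TV}}=\sup_S|\mu(S)-\nu(S)|$; for $0<\epsilon<1$, $t_1^{\mathrm{mix}}(\epsilon)=\inf\{n:\|\mu_A^{*n}-\mathbb{U}\|_{\mathrm{TV}}\le\epsilon\}$ and $t_1^{\mathrm{mix}}=t_1^{\mathrm{mix}}(1/e)$. *)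

theory Defs
  imports "HOL-Probability.Probability" "HOL-Number_Theory.Residues"
begin

definition sym_lazy_sets :: "nat \<Rightarrow> nat \<Rightarrow> int set set" where
  "sym_lazy_sets p k =
    {A. A \<subseteq> carrier (residue_ring (int p)) \<and> card A = 2 * k + 1 \<and>
        (\<forall>x \<in> carrier (residue_ring (int p)).
            x \<in> A \<longleftrightarrow> \<ominus>\<^bsub>residue_ring (int p)\<^esub> x \<in> A) \<and>
        \<zero>\<^bsub>residue_ring (int p)\<^esub> \<in> A}"

definition conv :: "nat \<Rightarrow> int pmf \<Rightarrow> int pmf \<Rightarrow> int pmf" where
  "conv p \<mu> \<nu> = map_pmf (\<lambda>(x, y). x \<oplus>\<^bsub>residue_ring (int p)\<^esub> y) (pair_pmf \<mu> \<nu>)"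

primrec conv_power :: "nat \<Rightarrow> int pmf \<Rightarrow> nat \<Rightarrow> int pmf" where
  "conv_power p \<mu> 0 = return_pmf \<zero>\<^bsub>residue_ring (int p)\<^esub>"
| "conv_power p \<mu> (Suc n) = conv p (conv_power p \<mu> n) \<mu>"

definition tv_dist :: "nat \<Rightarrow> int pmf \<Rightarrow> int pmf \<Rightarrow> real" where
  "tv_dist p \<mu> \<nu> =
    (SUP S \<in> Pow (carrier (residue_ring (int p))).
        \<bar>measure_pmf.prob \<mu> S - measure_pmf.prob \<nu> S\<bar>)"

text \<open>\<open>mixing_time\<close> is the infimum of a set of naturals, with the library's convention
  that the infimum of the empty set is \<open>0\<close>. The convention is never used for
  \<open>A \<in> sym_lazy_sets p k\<close> with \<open>p\<close> prime, \<open>k \<ge> 1\<close> and \<open>\<epsilon> > 0\<close>: such an \<open>A\<close> contains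
  \<open>0\<close> and a generator of the group, so the walk converges to the uniform distribution.\<close>

definition mixing_time :: "nat \<Rightarrow> int set \<Rightarrow> real \<Rightarrow> nat" where
  "mixing_time p A \<epsilon> =
    Inf {n. tv_dist p (conv_power p (pmf_of_set A) n)
              (pmf_of_set (carrier (residue_ring (int p)))) \<le> \<epsilon>}"

end

theory Submission
  imports Defs "HOL-Library.Poly_Mapping" "HOL-Real_Asymp.Real_Asymp"
begin

text \<open>Write \<open>\<mu>\<close> for the uniform measure on \<open>A\<close> and \<open>d n\<close> for the total variation distance of \<open>\<mu>\<^sup>n\<close> from
uniform. The window cannot be narrow because \<open>d\<close> falls slowly: \<open>d n - d (n + 1) \<le> 2 * k / (n + 1)\<close>
for every \<open>n\<close> (\<open>d_increment\<close>). To fall from above \<open>1 - \<epsilon>\<close> to \<open>\<epsilon>\<close> after time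
\<open>s = t(1 - \<epsilon>)\<close>, the distance therefore needs about \<open>(1 - 2 * \<epsilon>) * s / (2 * k)\<close> further steps.

\<^bold>\<open>Why the distance falls slowly.\<close> The difference \<open>\<mu> - \<delta>\<^sub>0\<close> is the average over \<open>a \<in> A\<close> of half the
second differences \<open>D\<^sub>a = \<delta>\<^sub>a + \<delta>\<^sub>-\<^sub>a - 2 * \<delta>\<^sub>0\<close>, so it is enough to bound
\<open>\<mu>\<^sup>n * D\<^sub>a\<close> for each \<open>a \<noteq> 0\<close>. By laziness and symmetry \<open>\<mu>\<close> is a mixture which with probability \<open>2 / (2 * k + 1)\<close>
takes the step \<open>(2 * \<delta>\<^sub>0 + \<delta>\<^sub>a + \<delta>\<^sub>-\<^sub>a) / 4\<close>. About \<open>2 * n / (2 * k + 1)\<close> of the \<open>n\<close> steps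
are of this kind. Up to a translation, \<open>j\<close> of them together form the binomial measure
\<open>((\<delta>\<^sub>0 + \<delta>\<^sub>a) / 2)\<^sup>2\<^sup>j\<close>, whose second difference in the direction \<open>a\<close> has total mass \<open>O(1 / j)\<close>: it
is the square of the first difference of a binomial measure on \<open>j\<close> trials, which has mass
\<open>O(1 / sqrt j)\<close> by the Cauchy--Schwarz inequality and the binomial variance. Averaging over \<open>j\<close>
gives \<open>O(k / n)\<close> (\<open>l1_power_second_difference\<close>). All this is a computation with the
\<open>\<ell>\<^sup>1\<close> norm in the real group ring of \<open>\<int>\<close>, a commutative ring, and it descends to \<open>\<int>/p\<int>\<close> by
pairing with \<open>p\<close>-periodic functions.

\<^bold>\<open>Why the mixing times exceed a multiple of k.\<close> The bound on the window is useful only if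
\<open>s\<close> is large compared with \<open>k\<close>, since mixing times are integers. After \<open>n\<close> steps the walk
sits on at most \<open>2 ^ (n + 2 * k)\<close> points (\<open>card_set_law\<close>), and it must occupy at least \<open>\<epsilon> * p\<close>
points once \<open>d n \<le> 1 - \<epsilon>\<close>. If \<open>n \<le> C * k\<close> and \<open>k \<le> ln p / ln (ln p)\<close>, then
\<open>2 ^ (n + 2 * k)\<close> is \<open>p ^ o(1)\<close>, which is too few. This is the one place where the bound on \<open>k\<close>
enters.

\<^bold>\<open>Comparison with t(1/e).\<close> The argument gives a window of order \<open>s / k\<close>, and the claim
has \<open>t(1/e)\<close> in place of \<open>s\<close>. If \<open>s \<ge> t(1/e) / 2\<close> this costs a factor of two. Otherwise
\<open>t(\<epsilon>) - s \<ge> t(1/e) - s > t(1/e) / 2\<close>, which is more than was asked.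

Mixing times are infima of sets of naturals, so it also has to be known that the walk converges.
This follows from the same bound (\<open>d_le\<close>): along a generator \<open>a\<close> the probabilities of
the translates of a set form a \<open>p\<close>-periodic sequence whose second differences tend to \<open>0\<close>, so the sequence
is nearly constant.\<close>

section \<open>The total mass norm on the real group ring\<close>

definition l1 :: "('a \<Rightarrow>\<^sub>0 real) \<Rightarrow> real" where
  "l1 u = (\<Sum>z\<in>Poly_Mapping.keys u. \<bar>Poly_Mapping.lookup u z\<bar>)"

lemma l1_eq_sum:
  assumes "finite Z" "Poly_Mapping.keys u \<subseteq> Z"
  shows "l1 u = (\<Sum>z\<in>Z. \<bar>Poly_Mapping.lookup u z\<bar>)"
  unfolding l1_def using assms by (intro sum.mono_neutral_left) (auto simp: in_keys_iff)

lemma l1_zero [simp]: "l1 0 = 0"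
  by (simp add: l1_def)

lemma l1_single [simp]: "l1 (Poly_Mapping.single k c) = \<bar>c\<bar>"
  by (simp add: l1_def)

lemma l1_one [simp]: "l1 (1 :: 'a::zero \<Rightarrow>\<^sub>0 real) = 1"
  using l1_single[of "0::'a" 1] by (simp del: l1_single)

lemma l1_add: "l1 (u + v) \<le> l1 u + l1 v"
proof -
  let ?Z = "Poly_Mapping.keys u \<union> Poly_Mapping.keys v"
  have "l1 (u + v) = (\<Sum>z\<in>?Z. \<bar>Poly_Mapping.lookup (u + v) z\<bar>)"
    by (rule l1_eq_sum) (auto simp: in_keys_iff lookup_add)
  also have "\<dots> \<le> (\<Sum>z\<in>?Z. \<bar>Poly_Mapping.lookup u z\<bar> + \<bar>Poly_Mapping.lookup v z\<bar>)"
    by (intro sum_mono) (simp add: lookup_add)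
  also have "\<dots> = l1 u + l1 v"
    by (simp add: sum.distrib l1_eq_sum[of ?Z u] l1_eq_sum[of ?Z v])
  finally show ?thesis .
qed

lemma l1_sum: "l1 (\<Sum>i\<in>I. f i) \<le> (\<Sum>i\<in>I. l1 (f i))"
proof (induction I rule: infinite_finite_induct)
  case (insert i I)
  then show ?case using l1_add[of "f i" "sum f I"] by simp
qed auto

lemma sum_monomials:
  "(\<Sum>z\<in>Poly_Mapping.keys u. Poly_Mapping.single z (Poly_Mapping.lookup u z)) = u"
  by (rule poly_mapping_eqI) (auto simp: lookup_sum lookup_single when_def in_keys_iff)

lemma l1_mult:
  fixes u v :: "'a::comm_monoid_add \<Rightarrow>\<^sub>0 real"
  shows "l1 (u * v) \<le> l1 u * l1 v"
proof -
  have "l1 (u * v) = l1 (\<Sum>y\<in>Poly_Mapping.keys u. \<Sum>z\<in>Poly_Mapping.keys v.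
      Poly_Mapping.single (y + z) (Poly_Mapping.lookup u y * Poly_Mapping.lookup v z))"
    by (subst (1) sum_monomials[of u, symmetric], subst (1) sum_monomials[of v, symmetric])
      (simp add: sum_product mult_single)
  also have "\<dots> \<le> (\<Sum>y\<in>Poly_Mapping.keys u. \<Sum>z\<in>Poly_Mapping.keys v.
      \<bar>Poly_Mapping.lookup u y\<bar> * \<bar>Poly_Mapping.lookup v z\<bar>)"
    by (intro order.trans[OF l1_sum] sum_mono order.trans[OF l1_sum]) (simp add: abs_mult)
  also have "\<dots> = l1 u * l1 v"
    by (simp add: l1_def sum_product)
  finally show ?thesis .
qed

lemma l1_nonneg: "0 \<le> l1 u"
  by (simp add: l1_def sum_nonneg)

lemma l1_power:
  fixes u :: "'a::comm_monoid_add \<Rightarrow>\<^sub>0 real"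
  shows "l1 (u ^ n) \<le> l1 u ^ n"
proof (induction n)
  case (Suc n)
  have "l1 (u ^ Suc n) \<le> l1 u * l1 (u ^ n)" by (simp add: l1_mult)
  also have "\<dots> \<le> l1 u * l1 u ^ n"
    using Suc by (intro mult_left_mono) (auto simp: l1_nonneg)
  finally show ?case by simp
qed simp

text \<open>The equality lets denominators be cleared inside the norm: the estimates below are
made for unnormalised measures with integer coefficients and divided at the end.\<close>

lemma l1_of_nat_mult:
  fixes u :: "'a::comm_monoid_add \<Rightarrow>\<^sub>0 real"
  shows "l1 (of_nat n * u) = real n * l1 u"
proof (rule antisym)
  have "l1 (of_nat n * u) \<le> l1 (Poly_Mapping.single (0::'a) (real n)) * l1 u"
    by (metis l1_mult single_of_nat)
  then show "l1 (of_nat n * u) \<le> real n * l1 u" by (simp only: l1_single abs_of_nat)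
next
  show "real n * l1 u \<le> l1 (of_nat n * u)"
  proof (cases "n = 0")
    case False
    have "u = Poly_Mapping.single 0 (1 / real n) * (of_nat n * u)"
      using False by (simp flip: single_of_nat mult.assoc add: mult_single)
    then have "l1 u \<le> 1 / real n * l1 (of_nat n * u)"
      using l1_mult[of "Poly_Mapping.single 0 (1 / real n)" "of_nat n * u"] by simp
    then show ?thesis using False by (simp add: field_simps)
  qed simp
qed

section \<open>Differences of binomial measures\<close>

lemma binomial_variance:
  "(\<Sum>i\<le>m. real (m choose i) * (2 * real i - real m)\<^sup>2) = real m * 2 ^ m"
proof -
  have B: "real (m choose i) = 2 ^ m * Bernstein m i (1 / 2)" if "i \<le> m" for i
    using that by (simp add: Bernstein_def power_one_over flip: power_add)
  have "(\<Sum>i\<le>m. real (m choose i) * (2 * real i - real m)\<^sup>2)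
      = (\<Sum>i\<le>m. 2 ^ m * (4 * (real i * (real i - 1) * Bernstein m i (1 / 2))
          + (4 - 4 * real m) * (real i * Bernstein m i (1 / 2))
          + (real m)\<^sup>2 * Bernstein m i (1 / 2)))"
    by (intro sum.cong refl) (simp add: B power2_eq_square algebra_simps)
  also have "\<dots> = 2 ^ m * (4 * (\<Sum>i\<le>m. real i * (real i - 1) * Bernstein m i (1 / 2))
          + (4 - 4 * real m) * (\<Sum>i\<le>m. real i * Bernstein m i (1 / 2))
          + (real m)\<^sup>2 * (\<Sum>i\<le>m. Bernstein m i (1 / 2)))"
    by (simp add: sum.distrib flip: sum_distrib_left)
  also have "\<dots> = real m * 2 ^ m"
    unfolding sum_kk_Bernstein sum_k_Bernstein sum_Bernstein
    by (simp add: power2_eq_square field_simps)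
  finally show ?thesis .
qed

lemma binomial_mean_deviation:
  "(\<Sum>i\<le>m. real (m choose i) * \<bar>2 * real i - real m\<bar>) \<le> 2 ^ m * sqrt (real m)"
proof -
  have "(\<Sum>i\<le>m. sqrt (real (m choose i)) * (sqrt (real (m choose i)) * \<bar>2 * real i - real m\<bar>))\<^sup>2
      \<le> (\<Sum>i\<le>m. (sqrt (real (m choose i)))\<^sup>2)
        * (\<Sum>i\<le>m. (sqrt (real (m choose i)) * \<bar>2 * real i - real m\<bar>)\<^sup>2)"
    by (rule Cauchy_Schwarz_ineq_sum)
  also have "\<dots> = (\<Sum>i\<le>m. real (m choose i)) * (\<Sum>i\<le>m. real (m choose i) * (2 * real i - real m)\<^sup>2)"
    by (simp add: power_mult_distrib)
  also have "\<dots> = (2 ^ m * sqrt (real m))\<^sup>2"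
    using choose_row_sum[of m]
    by (simp add: binomial_variance power_mult_distrib flip: of_nat_sum)
       (simp add: power2_eq_square)
  finally have "(\<Sum>i\<le>m. real (m choose i) * \<bar>2 * real i - real m\<bar>)\<^sup>2 \<le> (2 ^ m * sqrt (real m))\<^sup>2"
    by (simp only: mult.assoc[symmetric] real_sqrt_mult_self abs_of_nat)
  then show ?thesis
    by (rule power2_le_imp_le) simp
qed

text \<open>The coefficients of \<open>(1 + x) ^ j * (x - 1)\<close> are differences of adjacent binomial coefficients, and
\<open>(j choose (i - 1)) - (j choose i) = (Suc j choose i) * (2 * i - Suc j) / Suc j\<close> for \<open>i \<ge> 1\<close>. Their absolute
sum is therefore a mean deviation of a binomial distribution.\<close>

lemma binomial_deviation_sum:
  fixes x :: "'a::comm_ring_1"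
  shows "of_nat (Suc j) * ((1 + x) ^ j * (x - 1))
      = (\<Sum>i\<le>Suc j. of_int (int (Suc j choose i) * (2 * int i - int (Suc j))) * x ^ i)"
proof -
  have 1: "(\<Sum>i\<le>Suc j. of_nat (Suc j choose i) * x ^ i) = (1 + x) ^ Suc j"
    using binomial_ring[of x 1 "Suc j"] by (simp add: add.commute)
  have "(\<Sum>i\<le>Suc j. of_nat i * of_nat (Suc j choose i) * x ^ i)
      = (\<Sum>i\<le>j. of_nat (Suc i) * of_nat (Suc j choose Suc i) * x ^ Suc i)"
    by (subst sum.atMost_Suc_shift) simp
  also have "\<dots> = (\<Sum>i\<le>j. of_nat (Suc j) * x * (of_nat (j choose i) * x ^ i))"
  proof (rule sum.cong[OF refl])
    fix i
    have "of_nat (Suc i) * of_nat (Suc j choose Suc i) = (of_nat (Suc j) * of_nat (j choose i) :: 'a)"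
      by (simp only: Suc_times_binomial flip: of_nat_mult)
    then show "of_nat (Suc i) * of_nat (Suc j choose Suc i) * x ^ Suc i
        = of_nat (Suc j) * x * (of_nat (j choose i) * x ^ i)"
      by (simp only: power_Suc mult_ac)
  qed
  also have "\<dots> = of_nat (Suc j) * x * (1 + x) ^ j"
    using binomial_ring[of x 1 j] by (simp add: add.commute flip: sum_distrib_left)
  finally have 2: "(\<Sum>i\<le>Suc j. of_nat i * of_nat (Suc j choose i) * x ^ i)
      = of_nat (Suc j) * x * (1 + x) ^ j" .
  have "(\<Sum>i\<le>Suc j. of_int (int (Suc j choose i) * (2 * int i - int (Suc j))) * x ^ i)
     = (\<Sum>i\<le>Suc j. 2 * (of_nat i * of_nat (Suc j choose i) * x ^ i)
          - of_nat (Suc j) * (of_nat (Suc j choose i) * x ^ i))"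
    by (intro sum.cong refl) (simp only: of_int_mult of_int_diff of_int_of_nat_eq of_int_numeral algebra_simps)
  also have "\<dots> = 2 * (\<Sum>i\<le>Suc j. of_nat i * of_nat (Suc j choose i) * x ^ i)
       - of_nat (Suc j) * (\<Sum>i\<le>Suc j. of_nat (Suc j choose i) * x ^ i)"
    by (simp only: sum_subtractf sum_distrib_left)
  also have "\<dots> = of_nat (Suc j) * ((1 + x) ^ j * (x - 1))"
    unfolding 1 2 power_Suc by (simp only: algebra_simps mult_2)
  finally show ?thesis ..
qed

lemma l1_binomial_difference:
  fixes x :: "'a::comm_monoid_add \<Rightarrow>\<^sub>0 real"
  assumes "l1 x \<le> 1"
  shows "l1 ((1 + x) ^ j * (x - 1)) \<le> 2 ^ Suc j / sqrt (real (Suc j))"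
proof -
  have "real (Suc j) * l1 ((1 + x) ^ j * (x - 1))
      = l1 (of_nat (Suc j) * ((1 + x) ^ j * (x - 1)))"
    by (rule l1_of_nat_mult[symmetric])
  also have "\<dots> \<le> (\<Sum>i\<le>Suc j. l1 (of_int (int (Suc j choose i) * (2 * int i - int (Suc j))) * x ^ i))"
    unfolding binomial_deviation_sum by (rule l1_sum)
  also have "\<dots> \<le> (\<Sum>i\<le>Suc j. real (Suc j choose i) * \<bar>2 * real i - real (Suc j)\<bar>)"
  proof (rule sum_mono)
    fix i
    let ?c = "int (Suc j choose i) * (2 * int i - int (Suc j))"
    have "l1 (of_int ?c * x ^ i) \<le> l1 (of_int ?c :: 'a \<Rightarrow>\<^sub>0 real) * l1 (x ^ i)"
      by (rule l1_mult)
    also have "\<dots> \<le> l1 (of_int ?c :: 'a \<Rightarrow>\<^sub>0 real) * 1"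
      using l1_power[of x i] power_le_one[OF l1_nonneg assms, of i]
      by (intro mult_left_mono l1_nonneg) linarith
    also have "l1 (of_int ?c :: 'a \<Rightarrow>\<^sub>0 real) = \<bar>of_int ?c\<bar>"
      by (metis l1_single single_of_int)
    also have "\<bar>of_int ?c\<bar> * 1 = real (Suc j choose i) * \<bar>2 * real i - real (Suc j)\<bar>"
      by (simp add: abs_mult)
    finally show "l1 (of_int ?c * x ^ i) \<le> real (Suc j choose i) * \<bar>2 * real i - real (Suc j)\<bar>" .
  qed
  also have "\<dots> \<le> 2 ^ Suc j * sqrt (real (Suc j))"
    by (rule binomial_mean_deviation)
  finally have "real (Suc j) * l1 ((1 + x) ^ j * (x - 1)) \<le> 2 ^ Suc j * sqrt (real (Suc j))" .
  then have "l1 ((1 + x) ^ j * (x - 1)) \<le> 2 ^ Suc j * sqrt (real (Suc j)) / real (Suc j)"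
    by (simp only: pos_le_divide_eq[OF of_nat_0_less_iff[THEN iffD2, OF zero_less_Suc]] mult.commute)
  also have "\<dots> = 2 ^ Suc j / sqrt (real (Suc j))"
  proof -
    define s where "s = sqrt (real (Suc j))"
    have "s > 0" "real (Suc j) = s * s"
      unfolding s_def by (simp_all del: of_nat_Suc)
    then show ?thesis
      unfolding s_def[symmetric] by simp
  qed
  finally show ?thesis .
qed

text \<open>Since \<open>y\<close> is inverse to \<open>x\<close>, both factors are squares up to a power of \<open>y\<close>:
\<open>2 + x + y = y * (1 + x)\<^sup>2\<close> and \<open>x + y - 2 = y * (x - 1)\<^sup>2\<close>. Submultiplicativity then squares the
decay \<open>1 / sqrt j\<close> of the first difference.\<close>

lemma l1_second_difference:
  fixes x y :: "'a::comm_monoid_add \<Rightarrow>\<^sub>0 real"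
  assumes "x * y = 1" "l1 x \<le> 1" "l1 y \<le> 1"
  shows "l1 ((2 + x + y) ^ j * (x + y - 2)) \<le> 4 ^ Suc j / real (Suc j)"
proof -
  define b where "b = (1 + x) ^ j * (x - 1)"
  have "y * (1 + x)\<^sup>2 = y + 2 * (x * y) + x * (x * y)"
    and "y * (x - 1)\<^sup>2 = y - 2 * (x * y) + x * (x * y)"
    by (simp_all add: power2_eq_square algebra_simps)
  then have V: "2 + x + y = y * (1 + x)\<^sup>2" and D: "x + y - 2 = y * (x - 1)\<^sup>2"
    using assms(1) by (simp_all add: algebra_simps)
  have "(2 + x + y) ^ j * (x + y - 2) = y ^ Suc j * b\<^sup>2"
    unfolding V D b_def by (simp add: power_mult_distrib power2_eq_square mult_ac)
  then have "l1 ((2 + x + y) ^ j * (x + y - 2)) \<le> l1 (y ^ Suc j) * l1 (b\<^sup>2)"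
    by (simp only: l1_mult)
  also have "\<dots> \<le> 1 * (l1 b)\<^sup>2"
    using l1_power[of y "Suc j"] power_le_one[OF l1_nonneg assms(3), of "Suc j"]
    by (intro mult_mono l1_power l1_nonneg) auto
  also have "\<dots> \<le> (2 ^ Suc j / sqrt (real (Suc j)))\<^sup>2"
    unfolding b_def mult_1 by (intro power_mono l1_binomial_difference assms l1_nonneg)
  also have "\<dots> = (2 ^ Suc j)\<^sup>2 / real (Suc j)"
    by (simp add: power_divide)
  also have "(2 ^ Suc j)\<^sup>2 = (4::real) ^ Suc j"
    by (simp only: power2_eq_square flip: power_mult_distrib) simp
  finally show ?thesis .
qed

text \<open>For \<open>a + b = 1\<close> and a binomial variable \<open>J\<close> with parameters \<open>n\<close> and \<open>a\<close> this is the bound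
\<open>E (1 / (J + 1)) \<le> 1 / ((n + 1) * a)\<close>, by absorption of \<open>1 / (j + 1)\<close> into the binomial coefficient.\<close>

lemma binomial_sum_div_Suc:
  fixes a b :: real
  assumes "0 \<le> b"
  shows "(\<Sum>j\<le>n. real (n choose j) * (a ^ Suc j / real (Suc j)) * b ^ (n - j)) \<le> (a + b) ^ Suc n / real (Suc n)"
proof -
  have "real (Suc n) * (\<Sum>j\<le>n. real (n choose j) * (a ^ Suc j / real (Suc j)) * b ^ (n - j))
      = (\<Sum>j\<le>n. real (Suc n choose Suc j) * a ^ Suc j * b ^ (Suc n - Suc j))"
    unfolding sum_distrib_left
  proof (rule sum.cong[OF refl])
    fix j
    have "real (Suc n) * real (n choose j) = real (Suc j) * real (Suc n choose Suc j)"
      by (simp only: Suc_times_binomial flip: of_nat_mult)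
    then show "real (Suc n) * (real (n choose j) * (a ^ Suc j / real (Suc j)) * b ^ (n - j))
        = real (Suc n choose Suc j) * a ^ Suc j * b ^ (Suc n - Suc j)"
      by (simp add: field_simps del: of_nat_Suc binomial_Suc_Suc power_Suc)
  qed
  also have "\<dots> = (a + b) ^ Suc n - b ^ Suc n"
    unfolding binomial_ring[of a b "Suc n"]
    by (subst sum.atMost_Suc_shift) simp
  also have "\<dots> \<le> (a + b) ^ Suc n"
    using assms by simp
  finally show ?thesis
    by (simp only: pos_le_divide_eq[OF of_nat_0_less_iff[THEN iffD2, OF zero_less_Suc]] mult.commute)
qed

text \<open>The identity element and half of \<open>x + y\<close> together form half of the lazy step \<open>2 + x + y\<close>; the
remainder \<open>W\<close> of \<open>2 * (1 + x + y + R)\<close> commutes with it. Expanding the \<open>n\<close>-th power amounts to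
conditioning on the number \<open>j\<close> of lazy steps in the direction of \<open>x\<close>.\<close>

lemma l1_power_second_difference:
  fixes x y R :: "'a::comm_monoid_add \<Rightarrow>\<^sub>0 real"
  assumes xy: "x * y = 1" "l1 x \<le> 1" "l1 y \<le> 1"
  shows "l1 ((1 + x + y + R) ^ n * (x + y - 2)) \<le> 2 * (l1 R + 3) ^ Suc n / real (Suc n)"
proof -
  let ?U = "1 + x + y + R" and ?V = "2 + x + y" and ?D = "x + y - 2"
  define W where "W = x + y + of_nat 2 * R"
  have W: "l1 W \<le> 2 * l1 R + 2"
    using l1_add[of "x + y" "of_nat 2 * R"] l1_add[of x y] l1_of_nat_mult[of 2 R] xy
    unfolding W_def by linarith
  have "of_nat (2 ^ n) * (?U ^ n * ?D) = (of_nat 2 * ?U) ^ n * ?D"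
    by (simp only: power_mult_distrib mult.assoc of_nat_power)
  also have "of_nat 2 * ?U = ?V + W"
    by (simp add: W_def algebra_simps)
  also have "(?V + W) ^ n * ?D = (\<Sum>j\<le>n. of_nat (n choose j) * ((?V ^ j * ?D) * W ^ (n - j)))"
    unfolding binomial_ring[of ?V W n] sum_distrib_right by (simp only: mult_ac)
  finally have "real (2 ^ n) * l1 (?U ^ n * ?D)
      = l1 (\<Sum>j\<le>n. of_nat (n choose j) * ((?V ^ j * ?D) * W ^ (n - j)))"
    by (simp only: l1_of_nat_mult[symmetric])
  also have "\<dots> \<le> (\<Sum>j\<le>n. real (n choose j) * l1 ((?V ^ j * ?D) * W ^ (n - j)))"
    by (rule order.trans[OF l1_sum]) (simp only: l1_of_nat_mult order.refl)
  also have "\<dots> \<le> (\<Sum>j\<le>n. real (n choose j) * (4 ^ Suc j / real (Suc j)) * (2 * l1 R + 2) ^ (n - j))"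
    unfolding mult.assoc
  proof (intro sum_mono mult_left_mono)
    fix j
    have "l1 ((?V ^ j * ?D) * W ^ (n - j)) \<le> l1 (?V ^ j * ?D) * l1 (W ^ (n - j))"
      by (rule l1_mult)
    also have "\<dots> \<le> (4 ^ Suc j / real (Suc j)) * (2 * l1 R + 2) ^ (n - j)"
      using l1_power[of W "n - j"] power_mono[OF W l1_nonneg, of "n - j"]
      by (intro mult_mono l1_second_difference xy l1_nonneg) auto
    finally show "l1 (?V ^ j * (?D * W ^ (n - j))) \<le> (4 ^ Suc j / real (Suc j)) * (2 * l1 R + 2) ^ (n - j)"
      by (simp only: mult.assoc)
  qed auto
  also have "\<dots> \<le> (4 + (2 * l1 R + 2)) ^ Suc n / real (Suc n)"
    by (intro binomial_sum_div_Suc) (simp add: l1_nonneg)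
  also have "4 + (2 * l1 R + 2) = 2 * (l1 R + 3)"
    by simp
  finally have "2 ^ n * l1 (?U ^ n * ?D) \<le> 2 ^ n * (2 * (l1 R + 3) ^ Suc n / real (Suc n))"
    by (simp only: power_mult_distrib of_nat_power of_nat_numeral power_Suc
        times_divide_eq_right mult_ac)
  then show ?thesis
    by (simp only: mult_le_cancel_left_pos zero_less_power zero_less_numeral)
qed


section \<open>Pairing measures with functions\<close>

definition pairing :: "('a \<Rightarrow> real) \<Rightarrow> ('a \<Rightarrow>\<^sub>0 real) \<Rightarrow> real" where
  "pairing f u = (\<Sum>z\<in>Poly_Mapping.keys u. Poly_Mapping.lookup u z * f z)"

lemma pairing_eq_sum:
  assumes "finite Z" "Poly_Mapping.keys u \<subseteq> Z"
  shows "pairing f u = (\<Sum>z\<in>Z. Poly_Mapping.lookup u z * f z)"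
  unfolding pairing_def using assms by (intro sum.mono_neutral_left) (auto simp: in_keys_iff)

lemma pairing_zero [simp]: "pairing f 0 = 0"
  by (simp add: pairing_def)

lemma pairing_single [simp]: "pairing f (Poly_Mapping.single k c) = c * f k"
  by (simp add: pairing_def)

lemma pairing_add: "pairing f (u + v) = pairing f u + pairing f v"
proof -
  let ?Z = "Poly_Mapping.keys u \<union> Poly_Mapping.keys v"
  have "pairing f (u + v) = (\<Sum>z\<in>?Z. Poly_Mapping.lookup (u + v) z * f z)"
    by (rule pairing_eq_sum) (auto simp: in_keys_iff lookup_add)
  also have "\<dots> = pairing f u + pairing f v"
    by (simp add: lookup_add algebra_simps sum.distrib pairing_eq_sum[of ?Z u] pairing_eq_sum[of ?Z v])
  finally show ?thesis .
qed

lemma pairing_sum: "pairing f (\<Sum>i\<in>I. u i) = (\<Sum>i\<in>I. pairing f (u i))"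
  by (induction I rule: infinite_finite_induct) (simp_all add: pairing_add)

lemma pairing_single_mult:
  fixes u :: "'a::comm_monoid_add \<Rightarrow>\<^sub>0 real"
  shows "pairing f (Poly_Mapping.single k c * u) = c * pairing (\<lambda>z. f (k + z)) u"
proof -
  have "pairing f (Poly_Mapping.single k c * u)
      = pairing f (\<Sum>z\<in>Poly_Mapping.keys u. Poly_Mapping.single (k + z) (c * Poly_Mapping.lookup u z))"
    by (subst (1) sum_monomials[of u, symmetric]) (simp add: sum_distrib_left mult_single)
  then show ?thesis
    by (simp only: pairing_sum pairing_single) (simp add: pairing_def sum_distrib_left mult_ac)
qed

lemma pairing_diff: "pairing f (u - v) = pairing f u - pairing f v"
  using pairing_add[of f "u - v" v] by simp

lemma abs_pairing_le:
  assumes "\<And>z. \<bar>f z\<bar> \<le> 1"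
  shows "\<bar>pairing f u\<bar> \<le> l1 u"
  unfolding pairing_def l1_def
  by (intro order.trans[OF sum_abs] sum_mono) (simp add: abs_mult mult_left_le assms)

section \<open>Total variation distance\<close>

lemma tv_dist_le:
  assumes "\<And>S. S \<subseteq> carrier (residue_ring (int p)) \<Longrightarrow> \<bar>measure_pmf.prob \<mu> S - measure_pmf.prob \<nu> S\<bar> \<le> B"
  shows "tv_dist p \<mu> \<nu> \<le> B"
  unfolding tv_dist_def by (rule cSUP_least) (use assms in auto)

lemma tv_dist_ge:
  assumes "S \<subseteq> carrier (residue_ring (int p))"
  shows "\<bar>measure_pmf.prob \<mu> S - measure_pmf.prob \<nu> S\<bar> \<le> tv_dist p \<mu> \<nu>"
  unfolding tv_dist_def
proof (rule cSUP_upper)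
  have "\<bar>measure_pmf.prob \<mu> S - measure_pmf.prob \<nu> S\<bar> \<le> 1" for S
    using measure_pmf.prob_le_1[of \<mu> S] measure_pmf.prob_le_1[of \<nu> S]
      measure_nonneg[of \<mu> S] measure_nonneg[of \<nu> S] by linarith
  then show "bdd_above ((\<lambda>S. \<bar>measure_pmf.prob \<mu> S - measure_pmf.prob \<nu> S\<bar>) ` Pow (carrier (residue_ring (int p))))"
    by (intro bdd_aboveI2)
qed (use assms in auto)

section \<open>Periodic sequences with small second differences\<close>

text \<open>The first differences of a periodic sequence sum to zero over a period. If they vary slowly, then
each of them is close to their mean zero, and so the sequence is close to its average.\<close>

lemma periodic_almost_linear:
  fixes g :: "nat \<Rightarrow> real"
  assumes p: "0 < p"
    and per: "\<And>i. g (i + p) = g i"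
    and snd: "\<And>i. \<bar>g (i + 2) - 2 * g (i + 1) + g i\<bar> \<le> \<eta>"
  shows "\<bar>g 0 - (\<Sum>i<p. g i) / real p\<bar> \<le> (real p)\<^sup>2 * \<eta>"
proof -
  have \<eta>: "0 \<le> \<eta>" using snd[of 0] by linarith
  define h where "h i = g (Suc i) - g i" for i
  have h_shift: "\<bar>h i - h (i + m)\<bar> \<le> real m * \<eta>" for i m
  proof (induction m)
    case (Suc m)
    have "\<bar>h (i + m) - h (i + Suc m)\<bar> \<le> \<eta>"
      using snd[of "i + m"] by (simp add: h_def)
    then show ?case using Suc by (simp add: algebra_simps)
  qed simp
  have h_bound: "\<bar>h i\<bar> \<le> real p * \<eta>" for i
  proof -
    have "(\<Sum>j<p. h (i + j)) = g (i + p) - g i"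
      unfolding h_def using sum_lessThan_telescope[of "\<lambda>j. g (i + j)" p] by simp
    then have "real p * h i = (\<Sum>j<p. h i - h (i + j))"
      by (simp add: sum_subtractf per)
    then have "real p * \<bar>h i\<bar> = \<bar>\<Sum>j<p. h i - h (i + j)\<bar>"
      by (metis abs_mult abs_of_nat)
    also have "\<dots> \<le> (\<Sum>j<p. real p * \<eta>)"
    proof (intro order.trans[OF sum_abs] sum_mono)
      fix j assume "j \<in> {..<p}"
      then have "real j * \<eta> \<le> real p * \<eta>" using \<eta> by (intro mult_right_mono) auto
      then show "\<bar>h i - h (i + j)\<bar> \<le> real p * \<eta>" using h_shift[of i j] by linarith
    qed
    also have "\<dots> = real p * (real p * \<eta>)" by simp
    finally show ?thesis using p by (simp only: mult_le_cancel_left_pos of_nat_0_less_iff)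
  qed
  have g_shift: "\<bar>g 0 - g i\<bar> \<le> real i * (real p * \<eta>)" for i
  proof (induction i)
    case (Suc i)
    then show ?case using h_bound[of i] by (simp add: h_def algebra_simps)
  qed simp
  have "real p * \<bar>g 0 - (\<Sum>i<p. g i) / real p\<bar> = \<bar>real p * g 0 - (\<Sum>i<p. g i)\<bar>"
    using p by (simp add: abs_mult[of "real p", simplified, symmetric] right_diff_distrib)
  also have "\<dots> = \<bar>\<Sum>i<p. g 0 - g i\<bar>"
    by (simp add: sum_subtractf)
  also have "\<dots> \<le> (\<Sum>i<p. (real p)\<^sup>2 * \<eta>)"
  proof (intro order.trans[OF sum_abs] sum_mono)
    fix i assume "i \<in> {..<p}"
    then have "real i * (real p * \<eta>) \<le> real p * (real p * \<eta>)"
      using \<eta> by (intro mult_right_mono) auto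
    then show "\<bar>g 0 - g i\<bar> \<le> (real p)\<^sup>2 * \<eta>"
      using g_shift[of i] by (simp add: power2_eq_square mult.assoc)
  qed
  also have "\<dots> = real p * ((real p)\<^sup>2 * \<eta>)" by simp
  finally show ?thesis using p by (simp only: mult_le_cancel_left_pos of_nat_0_less_iff)
qed

section \<open>The walk as a power in the group ring\<close>

locale cycle_walk =
  fixes p k :: nat and A :: "int set"
  assumes prime: "prime p" and p_gt_2: "2 < p" and k_pos: "1 \<le> k"
    and A: "A \<in> sym_lazy_sets p k"
begin

sublocale residues "int p" "residue_ring (int p)"
  by unfold_locales (use p_gt_2 in auto)

abbreviation "G \<equiv> carrier (residue_ring (int p))"
abbreviation "N \<equiv> 2 * k + 1"
abbreviation "law \<equiv> conv_power p (pmf_of_set A)"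
abbreviation "d n \<equiv> tv_dist p (law n) (pmf_of_set G)"

lemma A_subset: "A \<subseteq> {0..<int p}" and zero_in_A: "0 \<in> A" and card_A: "card A = N"
  using A by (auto simp: sym_lazy_sets_def res_carrier_eq res_zero_eq)

lemma minus_in_A: "a \<in> A \<Longrightarrow> (- a) mod int p \<in> A"
  using A unfolding sym_lazy_sets_def res_neg_eq[symmetric] by blast

lemma finite_A: "finite A" and A_nonempty: "A \<noteq> {}"
  using A_subset finite_subset zero_in_A by auto

lemma G_eq: "G = {0..<int p}"
  by (auto simp: res_carrier_eq)

lemma odd_p: "odd p"
  using prime p_gt_2 prime_odd_nat by blast

definition periodic :: "(int \<Rightarrow> 'b) \<Rightarrow> bool" where
  "periodic f \<longleftrightarrow> (\<forall>y z. y mod int p = z mod int p \<longrightarrow> f y = f z)"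

lemma periodic_shift: "periodic f \<Longrightarrow> periodic (\<lambda>z. f (a + z))"
  unfolding periodic_def by (metis mod_add_right_eq)

text \<open>Representatives in the interval \<open>(-p/2, p/2)\<close>, and not in \<open>[0, p)\<close>, make the lifted set symmetric:
opposite elements of \<open>A\<close> lift to opposite integers, so their monomials are inverse to each other in
the group ring.\<close>

definition lift :: "int \<Rightarrow> int" where
  "lift a = (if 2 * a < int p then a else a - int p)"

lemma lift_mod: "(lift a + z) mod int p = (a + z) mod int p"
proof -
  have "a - int p + z = (a + z) - int p" by simp
  then have "(a - int p + z) mod int p = (a + z) mod int p"
    by (simp only: minus_mod_self2)
  then show ?thesis
    by (simp only: lift_def split: if_split) simp
qed

lemma minus_mod_eq:
  assumes "a \<in> A" "a \<noteq> 0"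
  shows "(- a) mod int p = int p - a"
proof -
  have "0 < a" "a < int p" using subsetD[OF A_subset assms(1)] assms(2) by auto
  then have "(- a + int p) mod int p = - a + int p"
    by (intro mod_pos_pos_trivial) auto
  then show ?thesis by simp
qed

lemma lift_minus: assumes "a \<in> A" shows "lift ((- a) mod int p) = - lift a"
proof (cases "a = 0")
  case False
  have "2 * a \<noteq> int p" using odd_p by presburger
  then show ?thesis using minus_mod_eq[OF assms False] by (auto simp: lift_def)
qed (simp add: lift_def)

definition step :: "int \<Rightarrow> (int \<Rightarrow>\<^sub>0 real)" where
  "step a = Poly_Mapping.single (lift a) 1"

text \<open>The lift of \<open>(2 * k + 1) * \<mu>\<close> to a measure on \<open>\<int>\<close>.\<close>

definition step_sum :: "int \<Rightarrow>\<^sub>0 real" where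
  "step_sum = (\<Sum>a\<in>A. step a)"

lemma l1_step: "l1 (step a) = 1"
  by (simp add: step_def)

lemma step_minus: "a \<in> A \<Longrightarrow> step a * step ((- a) mod int p) = 1"
  by (simp add: step_def lift_minus mult_single)

lemma sum_step_minus: "(\<Sum>a\<in>A. step ((- a) mod int p)) = step_sum"
  unfolding step_sum_def
proof (rule sum.reindex_bij_witness[where i = "\<lambda>a. (- a) mod int p" and j = "\<lambda>a. (- a) mod int p"])
  fix a assume "a \<in> A"
  then show "(- ((- a) mod int p)) mod int p = a"
    using A_subset mod_minus_eq[of "- a" "int p"] by auto
  then show "(- ((- a) mod int p)) mod int p = a" .
qed (auto simp: minus_in_A)

lemma pairing_step_mult:
  assumes "periodic f"
  shows "pairing f (step a * u) = pairing (\<lambda>z. f (a + z)) u"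
proof -
  have "f (lift a + z) = f (a + z)" for z
    using assms lift_mod[of a z] unfolding periodic_def by blast
  then show ?thesis
    by (simp add: step_def pairing_single_mult)
qed

lemma conv_eq_bind:
  "conv p \<mu> \<nu> = bind_pmf \<nu> (\<lambda>a. map_pmf (\<lambda>x. (a + x) mod int p) \<mu>)"
  unfolding conv_def pair_pmf_def
  by (subst bind_commute_pmf) (simp add: map_bind_pmf map_pmf_def bind_assoc_pmf bind_return_pmf res_add_eq add.commute)

lemma set_law_subset: "set_pmf (law n) \<subseteq> G"
proof (cases n)
  case (Suc m)
  then show ?thesis using p_gt_2 by (auto simp: conv_eq_bind G_eq)
qed (use p_gt_2 in \<open>auto simp: G_eq res_zero_eq\<close>)

lemma finite_set_law: "finite (set_pmf (law n))"
  using set_law_subset[of n] by (rule finite_subset) (simp add: G_eq)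

lemma expectation_law_Suc:
  assumes "periodic (f :: int \<Rightarrow> real)"
  shows "real N * measure_pmf.expectation (law (Suc n)) f
    = (\<Sum>a\<in>A. measure_pmf.expectation (law n) (\<lambda>z. f (a + z)))"
proof -
  have "measure_pmf.expectation (law (Suc n)) f
      = (\<Sum>a\<in>A. measure_pmf.expectation (map_pmf (\<lambda>x. (a + x) mod int p) (law n)) f /\<^sub>R real (card A))"
    unfolding conv_power.simps conv_eq_bind
    by (rule pmf_expectation_bind_pmf_of_set) (auto simp: A_nonempty finite_A finite_set_law)
  moreover have "f ((a + x) mod int p) = f (a + x)" for a x
    using assms[unfolded periodic_def, rule_format, of "(a + x) mod int p" "a + x"] by simp
  ultimately show ?thesis
    by (simp add: card_A add_pos_nonneg[THEN less_imp_neq, symmetric] flip: sum_distrib_left mult.assoc)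
qed

text \<open>Periodic functions cannot tell the walk on \<open>\<int>/p\<int>\<close> from its lift to \<open>\<int>\<close>. This carries norm
estimates from the group ring to the walk.\<close>

lemma expectation_law:
  assumes "periodic (f :: int \<Rightarrow> real)"
  shows "real N ^ n * measure_pmf.expectation (law n) f = pairing f (step_sum ^ n)"
  using assms
proof (induction n arbitrary: f)
  case 0
  have "pairing f 1 = f 0"
    using pairing_single[of f 0 1] by (simp del: pairing_single)
  then show ?case by (simp add: res_zero_eq)
next
  case (Suc n)
  have "real N ^ Suc n * measure_pmf.expectation (law (Suc n)) f
      = real N ^ n * (real N * measure_pmf.expectation (law (Suc n)) f)"
    by simp
  also have "\<dots> = (\<Sum>a\<in>A. real N ^ n * measure_pmf.expectation (law n) (\<lambda>z. f (a + z)))"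
    unfolding expectation_law_Suc[OF Suc.prems] sum_distrib_left ..
  also have "\<dots> = (\<Sum>a\<in>A. pairing f (step a * step_sum ^ n))"
    using Suc by (simp add: pairing_step_mult periodic_shift)
  also have "\<dots> = pairing f (step_sum ^ Suc n)"
    by (simp add: step_sum_def sum_distrib_right flip: pairing_sum)
  finally show ?case .
qed

lemma prob_law:
  "measure_pmf.prob (law n) S = measure_pmf.expectation (law n) (\<lambda>z. indicator S (z mod int p))"
proof -
  have "measure_pmf.prob (law n) S = measure_pmf.expectation (law n) (indicator S)"
    by simp
  also have "\<dots> = measure_pmf.expectation (law n) (\<lambda>z. indicator S (z mod int p))"
    using set_law_subset[of n]
    by (intro integral_cong_AE) (auto simp: AE_measure_pmf_iff G_eq dest!: subsetD)
  finally show ?thesis .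
qed

lemma periodic_indicator: "periodic (\<lambda>z. indicator S (z mod int p) :: real)"
  by (simp add: periodic_def)

section \<open>One more step changes the law little\<close>

text \<open>The three distinct elements \<open>0\<close>, \<open>a\<close> and \<open>-a\<close> of \<open>A\<close> supply the lazy step in the direction of
\<open>a\<close>; the other \<open>2 * k - 2\<close> elements are the remainder.\<close>

lemma l1_step_sum_second_difference:
  assumes "a \<in> A"
  shows "l1 (step_sum ^ n * (step a + step ((- a) mod int p) - 2)) \<le> (if a = 0 then 0 else 2 * real N ^ Suc n / real (Suc n))"
proof (cases "a = 0")
  case True
  have "step 0 = 1" by (simp add: step_def lift_def p_gt_2)
  with True show ?thesis by simp
next
  case False
  define b where "b = (- a) mod int p"
  define R where "R = (\<Sum>c\<in>A - {0, a, b}. step c)"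
  have b: "b \<in> A" "b \<noteq> 0" "b \<noteq> a"
  proof -
    show "b \<in> A" using minus_in_A[OF assms] by (simp add: b_def)
    have "b = int p - a" using minus_mod_eq[OF assms False] by (simp add: b_def)
    moreover have "2 * a \<noteq> int p" using odd_p by presburger
    ultimately show "b \<noteq> 0" "b \<noteq> a" using assms A_subset by auto
  qed
  have sub: "{0, a, b} \<subseteq> A" using zero_in_A assms b by auto
  have "step 0 = 1" using p_gt_2 by (simp add: step_def lift_def)
  then have "(\<Sum>c\<in>{0, a, b}. step c) = 1 + step a + step b"
    using False b by (auto simp: add.assoc)
  then have step_sum: "step_sum = 1 + step a + step b + R"
    unfolding step_sum_def R_def using sum.subset_diff[OF sub finite_A, of step] by (simp add: add.commute)
  have "l1 R \<le> real (card (A - {0, a, b}))"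
    unfolding R_def using l1_sum[of step "A - {0, a, b}"] by (simp add: l1_step)
  also have "card {0, a, b} = 3" using False b by auto
  then have "card (A - {0, a, b}) = 2 * k - 2"
    using card_Diff_subset[OF _ sub] by (simp add: card_A)
  finally have R: "l1 R + 3 \<le> real N" using k_pos by simp
  have "l1 (step_sum ^ n * (step a + step b - 2)) \<le> 2 * (l1 R + 3) ^ Suc n / real (Suc n)"
    unfolding step_sum using step_minus[OF assms]
    by (intro l1_power_second_difference) (auto simp: l1_step b_def)
  also have "\<dots> \<le> 2 * real N ^ Suc n / real (Suc n)"
    using R l1_nonneg[of R] by (intro divide_right_mono mult_left_mono power_mono) auto
  finally show ?thesis using False by (simp only: b_def if_False)
qed

text \<open>Pairing \<open>a\<close> with \<open>-a\<close> turns \<open>2 * (step_sum - (2 * k + 1))\<close> into a sum of second differences, where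
\<open>a = 0\<close> contributes nothing and so \<open>2 * k\<close> terms are left.\<close>

lemma l1_step_sum_increment:
  "l1 (step_sum ^ Suc n - of_nat N * step_sum ^ n) \<le> 2 * real k * real N ^ Suc n / real (Suc n)"
proof -
  have "of_nat 2 * (step_sum ^ Suc n - of_nat N * step_sum ^ n)
      = step_sum ^ n * (step_sum + step_sum - 2 * of_nat N)"
    by (simp add: algebra_simps)
  also have "step_sum + step_sum - 2 * of_nat N = (\<Sum>a\<in>A. step a + step ((- a) mod int p) - 2)"
    by (simp add: sum.distrib sum_subtractf sum_step_minus flip: step_sum_def) (simp add: card_A algebra_simps)
  finally have "2 * l1 (step_sum ^ Suc n - of_nat N * step_sum ^ n)
      = l1 (\<Sum>a\<in>A. step_sum ^ n * (step a + step ((- a) mod int p) - 2))"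
    using l1_of_nat_mult[of 2 "step_sum ^ Suc n - of_nat N * step_sum ^ n"] by (simp only: sum_distrib_left of_nat_numeral)
  also have "\<dots> \<le> (\<Sum>a\<in>A. if a = 0 then 0 else 2 * real N ^ Suc n / real (Suc n))"
    by (intro order.trans[OF l1_sum] sum_mono l1_step_sum_second_difference)
  also have "\<dots> = (\<Sum>a\<in>A - {0}. 2 * real N ^ Suc n / real (Suc n))"
    by (intro sum.mono_neutral_cong_right finite_A) auto
  also have "\<dots> = 2 * (2 * real k * real N ^ Suc n / real (Suc n))"
    using zero_in_A finite_A card_A by (simp del: power_Suc of_nat_Suc)
  finally show ?thesis by simp
qed

lemma expectation_increment:
  assumes "periodic f" "\<And>z. \<bar>f z\<bar> \<le> 1"
  shows "\<bar>measure_pmf.expectation (law (Suc n)) f - measure_pmf.expectation (law n) f\<bar> \<le> 2 * real k / real (Suc n)"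
proof -
  let ?E = "\<lambda>n. measure_pmf.expectation (law n) f"
  have "pairing f (of_nat N * step_sum ^ n) = real N * pairing f (step_sum ^ n)"
    using pairing_single_mult[of f 0 "real N" "step_sum ^ n"] by (simp only: single_of_nat add_0)
  then have "pairing f (step_sum ^ Suc n - of_nat N * step_sum ^ n) = real N ^ Suc n * (?E (Suc n) - ?E n)"
    unfolding pairing_diff expectation_law[OF assms(1), symmetric] by (simp add: algebra_simps)
  then have "real N ^ Suc n * \<bar>?E (Suc n) - ?E n\<bar> = \<bar>pairing f (step_sum ^ Suc n - of_nat N * step_sum ^ n)\<bar>"
    by (simp only: abs_mult) simp
  also have "\<dots> \<le> real N ^ Suc n * (2 * real k / real (Suc n))"
    using order.trans[OF abs_pairing_le l1_step_sum_increment, OF assms(2)] by (simp add: mult_ac del: power_Suc of_nat_Suc)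
  finally show ?thesis
    by (rule mult_left_le_imp_le) simp
qed

lemma d_increment: "d n \<le> d (Suc n) + 2 * real k / real (Suc n)"
proof (rule tv_dist_le)
  fix S assume S: "S \<subseteq> G"
  have "\<bar>measure_pmf.prob (law (Suc n)) S - measure_pmf.prob (law n) S\<bar> \<le> 2 * real k / real (Suc n)"
    unfolding prob_law by (intro expectation_increment periodic_indicator) (simp add: indicator_def)
  then show "\<bar>measure_pmf.prob (law n) S - measure_pmf.prob (pmf_of_set G) S\<bar> \<le> d (Suc n) + 2 * real k / real (Suc n)"
    using tv_dist_ge[OF S, of "law (Suc n)" "pmf_of_set G"] by linarith
qed

lemma d_increments:
  assumes "n \<le> m"
  shows "d n \<le> d m + real (m - n) * (2 * real k / real (Suc n))"
  using assms
proof (induction m rule: dec_induct)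
  case (step m)
  have "2 * real k / real (Suc m) \<le> 2 * real k / real (Suc n)"
    using step by (intro divide_left_mono) auto
  then show ?case
    using step.IH d_increment[of m] step.hyps(1)
    by (simp only: Suc_diff_le of_nat_Suc[of "m - n"] distrib_right mult_1)
qed simp

section \<open>Convergence to the uniform distribution\<close>

lemma finite_G: "finite G" and card_G: "card G = p"
  by (simp_all add: G_eq)

lemma prob_uniform: "S \<subseteq> G \<Longrightarrow> measure_pmf.prob (pmf_of_set G) S = real (card S) / real p"
  by (subst measure_pmf_of_set) (use p_gt_2 finite_G card_G in \<open>auto simp: Int_absorb1 G_eq\<close>)

lemma translates_cover:
  assumes "a \<in> A" "a \<noteq> 0"
  shows "bij_betw (\<lambda>i. (int i * a + z) mod int p) {..<p} G"
proof -
  let ?\<phi> = "\<lambda>i. (int i * a + z) mod int p"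
  have a: "0 < a" "a < int p" using subsetD[OF A_subset assms(1)] assms(2) by auto
  have inj: "inj_on ?\<phi> {..<p}"
  proof (rule inj_onI)
    fix i j assume ij: "i \<in> {..<p}" "j \<in> {..<p}" "?\<phi> i = ?\<phi> j"
    then have "int p dvd (int i * a + z) - (int j * a + z)"
      by (simp only: mod_eq_dvd_iff)
    then have "int p dvd (int i - int j) * a" by (simp add: algebra_simps)
    then have "int p dvd int i - int j \<or> int p dvd a"
      using prime by (simp add: prime_dvd_mult_iff)
    moreover have "\<not> int p dvd a" using a zdvd_not_zless by blast
    ultimately have "int i mod int p = int j mod int p"
      by (simp add: mod_eq_dvd_iff)
    then show "i = j" using ij by simp
  qed
  have "?\<phi> ` {..<p} \<subseteq> G" using p_gt_2 by (auto simp: G_eq)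
  then have "?\<phi> ` {..<p} = G"
    by (intro card_subset_eq finite_G) (simp_all add: card_image[OF inj] card_G)
  with inj show ?thesis by (simp add: bij_betw_def)
qed

text \<open>Apply \<open>periodic_almost_linear\<close> to the probabilities of the translates of \<open>S\<close> by multiples of a
nonzero \<open>a \<in> A\<close>. The average over a period is the uniform measure of \<open>S\<close>, as the multiples of
\<open>a\<close> exhaust the group. The crude factor \<open>p\<^sup>2\<close> is harmless because only the limit in \<open>n\<close> matters.\<close>

lemma d_le: "d n \<le> (real p)\<^sup>2 * (2 * real N / real (Suc n))"
proof (rule tv_dist_le)
  fix S assume S: "S \<subseteq> G"
  obtain a where a: "a \<in> A" "a \<noteq> 0"
  proof -
    have "card A \<noteq> card {0::int}" using card_A k_pos by simp
    then have "A \<noteq> {0}" by metis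
    then show ?thesis using that zero_in_A by blast
  qed
  define f :: "int \<Rightarrow> real" where "f z = indicator S (z mod int p)" for z
  define g where "g i = measure_pmf.expectation (law n) (\<lambda>z. f (int i * a + z))" for i :: nat
  have f_per: "periodic f" unfolding f_def by (rule periodic_indicator)
  have f_cong: "f y = f z" if "y mod int p = z mod int p" for y z
    using that by (simp add: f_def)
  have "\<bar>g (i + 2) - 2 * g (i + 1) + g i\<bar> \<le> 2 * real N / real (Suc n)" for i
  proof -
    define h where "h z = f (int (i + 1) * a + z)" for z
    have h_per: "periodic h" unfolding h_def using f_per by (rule periodic_shift)
    let ?b = "(- a) mod int p"
    have "h (?b + z) = f (int i * a + z)" for z
      unfolding h_def
    proof (rule f_cong)
      have "(int (i + 1) * a + (?b + z)) mod int p = (int (i + 1) * a + z + ?b) mod int p"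
        by (simp only: ac_simps)
      also have "\<dots> = (int (i + 1) * a + z + - a) mod int p" by (rule mod_add_right_eq)
      finally show "(int (i + 1) * a + (?b + z)) mod int p = (int i * a + z) mod int p"
        by (simp add: algebra_simps)
    qed
    then have 1: "pairing h (step_sum ^ n * step ?b) = real N ^ n * g i"
      unfolding mult.commute[of _ "step ?b"] pairing_step_mult[OF h_per]
      by (simp only: g_def expectation_law[OF periodic_shift[OF f_per]])
    have "h (a + z) = f (int (i + 2) * a + z)" for z
      by (simp add: h_def algebra_simps)
    then have 2: "pairing h (step_sum ^ n * step a) = real N ^ n * g (i + 2)"
      unfolding mult.commute[of _ "step a"] pairing_step_mult[OF h_per]
      by (simp only: g_def expectation_law[OF periodic_shift[OF f_per]])
    have 3: "pairing h (step_sum ^ n * 2) = real N ^ n * (2 * g (i + 1))"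
    proof -
      have "pairing h (step_sum ^ n * 2) = 2 * pairing h (step_sum ^ n)"
        using pairing_single_mult[of h 0 2 "step_sum ^ n"] by (simp add: mult.commute)
      moreover have "measure_pmf.expectation (law n) h = g (i + 1)"
        by (simp only: g_def flip: h_def)
      ultimately show ?thesis by (simp flip: expectation_law[OF h_per])
    qed
    have "real N ^ n * (g (i + 2) - 2 * g (i + 1) + g i)
        = pairing h (step_sum ^ n * (step a + step ?b - 2))"
      unfolding right_diff_distrib distrib_left pairing_diff pairing_add 1 2 3 by simp
    then have "real N ^ n * \<bar>g (i + 2) - 2 * g (i + 1) + g i\<bar>
        = \<bar>pairing h (step_sum ^ n * (step a + step ?b - 2))\<bar>"
      by (metis abs_mult abs_of_nat of_nat_power)
    also have "\<dots> \<le> 2 * real N ^ Suc n / real (Suc n)"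
    proof (rule order.trans[OF abs_pairing_le])
      show "\<bar>h z\<bar> \<le> 1" for z by (simp add: h_def f_def indicator_def)
      show "l1 (step_sum ^ n * (step a + step ?b - 2)) \<le> 2 * real N ^ Suc n / real (Suc n)"
        using l1_step_sum_second_difference[OF a(1), of n] a(2) by (simp only: if_False)
    qed
    also have "\<dots> = real N ^ n * (2 * real N / real (Suc n))" by simp
    finally show ?thesis by (rule mult_left_le_imp_le) simp
  qed
  moreover have "g (i + p) = g i" for i
  proof -
    have "f (int (i + p) * a + z) = f (int i * a + z)" for z
    proof (rule f_cong)
      have "int (i + p) * a + z = int i * a + z + int p * a" by (simp add: algebra_simps)
      then show "(int (i + p) * a + z) mod int p = (int i * a + z) mod int p"
        by (simp only: mod_mult_self2)
    qed
    then show ?thesis by (simp only: g_def)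
  qed
  ultimately have "\<bar>g 0 - (\<Sum>i<p. g i) / real p\<bar> \<le> (real p)\<^sup>2 * (2 * real N / real (Suc n))"
    using p_gt_2 by (intro periodic_almost_linear) auto
  moreover have "g 0 = measure_pmf.prob (law n) S"
    by (simp add: g_def prob_law f_def)
  moreover have "(\<Sum>i<p. g i) = real (card S)"
  proof -
    have "(\<Sum>i<p. g i) = measure_pmf.expectation (law n) (\<lambda>z. \<Sum>i<p. f (int i * a + z))"
      unfolding g_def
      by (subst Bochner_Integration.integral_sum)
        (auto intro!: integrable_measure_pmf_finite finite_set_law)
    also have "(\<lambda>z. \<Sum>i<p. f (int i * a + z)) = (\<lambda>z. real (card S))"
    proof
      fix z
      have "(\<Sum>i<p. f (int i * a + z)) = (\<Sum>y\<in>G. indicator S y)"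
        unfolding f_def by (rule sum.reindex_bij_betw[OF translates_cover[OF a]])
      also have "\<dots> = real (card S)"
        using S finite_G by (simp add: indicator_def sum.If_cases Int_absorb1)
      finally show "(\<Sum>i<p. f (int i * a + z)) = real (card S)" .
    qed
    finally show ?thesis by simp
  qed
  ultimately show "\<bar>measure_pmf.prob (law n) S - measure_pmf.prob (pmf_of_set G) S\<bar>
      \<le> (real p)\<^sup>2 * (2 * real N / real (Suc n))"
    using prob_uniform[OF S] by simp
qed

lemma d_eventually_le:
  assumes "0 < e"
  shows "\<exists>n. d n \<le> e"
proof -
  obtain n :: nat where n: "(real p)\<^sup>2 * (2 * real N) / e < real n"
    using reals_Archimedean2 by blast
  have "(real p)\<^sup>2 * (2 * real N) < e * real (Suc n)"
    using n assms by (simp add: pos_divide_less_eq algebra_simps)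
  then have "(real p)\<^sup>2 * (2 * real N / real (Suc n)) \<le> e"
    by (simp add: pos_divide_le_eq del: of_nat_Suc)
  then show ?thesis using d_le[of n] by (intro exI[of _ n]) linarith
qed

text \<open>The infimum is attained: by convergence it is taken over a nonempty set.\<close>

lemma d_mixing_time: "0 < e \<Longrightarrow> d (mixing_time p A e) \<le> e"
  using Inf_nat_def1[of "{n. d n \<le> e}"] d_eventually_le[of e] by (auto simp: mixing_time_def)

lemma mixing_time_le: "d n \<le> e \<Longrightarrow> mixing_time p A e \<le> n"
  unfolding mixing_time_def by (rule cInf_lower) auto

lemma mixing_time_antimono: "0 < e \<Longrightarrow> e \<le> e' \<Longrightarrow> mixing_time p A e' \<le> mixing_time p A e"
  using d_mixing_time[of e] by (intro mixing_time_le) linarith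

section \<open>The support of the walk\<close>

text \<open>The position after \<open>n\<close> steps depends only on how often each element of \<open>A\<close> was used, as the group is
commutative. There are \<open>(n + 2 * k) choose n\<close> such vectors of multiplicities.\<close>

lemma card_set_law: "card (set_pmf (law n)) \<le> 2 ^ (n + 2 * k)"
proof -
  obtain xs where xs: "set xs = A" "length xs = N"
    using finite_distinct_list[OF finite_A] card_A distinct_card by metis
  let ?L = "\<lambda>n. {l :: nat list. length l = N \<and> sum_list l = n}"
  let ?\<phi> = "\<lambda>l. (\<Sum>i<N. int (l ! i) * xs ! i) mod int p"
  have "set_pmf (law n) \<subseteq> ?\<phi> ` ?L n"
  proof (induction n)
    case 0
    have "(\<Sum>i<N. int (replicate N 0 ! i) * xs ! i) = 0"
      by (intro sum.neutral ballI) (simp only: lessThan_iff List.nth_replicate of_nat_0 mult_zero_left)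
    then have "?\<phi> (replicate N 0) = 0" by (simp only: mod_0)
    moreover have "replicate N 0 \<in> ?L 0" by (simp add: sum_list_replicate)
    ultimately have "0 \<in> ?\<phi> ` ?L 0" by (rule image_eqI[OF sym])
    then show ?case by (simp only: conv_power.simps set_return_pmf res_zero_eq empty_subsetI insert_subset simp_thms)
  next
    case (Suc n)
    show ?case
    proof
      fix x assume "x \<in> set_pmf (law (Suc n))"
      then obtain a y where a: "a \<in> A" and y: "y \<in> set_pmf (law n)" and x: "x = (a + y) mod int p"
        using finite_A A_nonempty by (auto simp: conv_eq_bind)
      obtain j where j: "j < N" "xs ! j = a" using a xs by (metis in_set_conv_nth)
      obtain l where l: "l \<in> ?L n" "y = ?\<phi> l" using y Suc by blast
      let ?l = "l[j := Suc (l ! j)]"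
      have "sum_list ?l = Suc n"
        using l j member_le_sum_list[of "l ! j" l] by (simp add: sum_list_update)
      then have "?l \<in> ?L (Suc n)" using l by simp
      moreover have "x = ?\<phi> ?l"
      proof -
        have "(\<Sum>i<N. int (?l ! i) * xs ! i) = (\<Sum>i<N. int (l ! i) * xs ! i + (if i = j then a else 0))"
          using l j by (intro sum.cong) (auto simp: nth_list_update algebra_simps)
        also have "\<dots> = a + (\<Sum>i<N. int (l ! i) * xs ! i)"
          using j by (simp add: sum.distrib)
        finally show ?thesis
          unfolding x l(2) by (simp only: mod_add_right_eq)
      qed
      ultimately show "x \<in> ?\<phi> ` ?L (Suc n)" by blast
    qed
  qed
  moreover have fin: "finite (?L n)"
  proof (rule finite_subset)
    show "?L n \<subseteq> {l. set l \<subseteq> {..n} \<and> length l = N}"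
      using member_le_sum_list by fastforce
  qed (simp add: finite_lists_length_eq)
  ultimately have "card (set_pmf (law n)) \<le> card (?L n)"
    using card_mono card_image_le finite_imageI order.trans by meson
  also have "\<dots> = (n + 2 * k) choose n"
    by (simp add: card_length_sum_list)
  also have "\<dots> \<le> 2 ^ (n + 2 * k)"
    by (rule binomial_le_pow2)
  finally show ?thesis .
qed

lemma support_lower_bound:
  assumes "d n \<le> 1 - \<epsilon>"
  shows "\<epsilon> * real p \<le> 2 ^ (n + 2 * k)"
proof -
  let ?S = "set_pmf (law n)"
  have "\<bar>measure_pmf.prob (law n) ?S - measure_pmf.prob (pmf_of_set G) ?S\<bar> \<le> 1 - \<epsilon>"
    using tv_dist_ge[OF set_law_subset] assms by (rule order.trans)
  moreover have "measure_pmf.prob (law n) ?S = 1"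
    by (simp add: measure_pmf.prob_eq_1 AE_measure_pmf)
  ultimately have "\<epsilon> \<le> real (card ?S) / real p"
    using prob_uniform[OF set_law_subset, of n] by linarith
  then have "\<epsilon> * real p \<le> real (card ?S)"
    using p_gt_2 by (simp add: pos_le_divide_eq)
  also have "\<dots> \<le> real (2 ^ (n + 2 * k))"
    using card_set_law by (simp only: of_nat_le_iff)
  finally show ?thesis by simp
qed

section \<open>The mixing window\<close>

text \<open>Telescoping starts at time \<open>s - 1\<close>, the last one at which the distance is known to exceed
\<open>1 - \<epsilon>\<close>. This loses one step. The hypothesis says that the gain \<open>(1 - 2 * \<epsilon>) * s / (2 * k)\<close>
is at least two, so half of it survives the loss.\<close>

lemma mixing_window:
  assumes \<epsilon>: "0 < \<epsilon>" "\<epsilon> < 1 / 2"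
    and large: "4 * real k \<le> (1 - 2 * \<epsilon>) * real (mixing_time p A (1 - \<epsilon>))"
  shows "real (mixing_time p A \<epsilon>) - real (mixing_time p A (1 - \<epsilon>))
    \<ge> (1 - 2 * \<epsilon>) / 4 * (real (mixing_time p A (1 - \<epsilon>)) / real k)"
proof -
  define s where "s = mixing_time p A (1 - \<epsilon>)"
  define t where "t = mixing_time p A \<epsilon>"
  have "s \<noteq> 0" using large k_pos unfolding s_def by (auto intro: ccontr)
  then obtain n where n: "s = Suc n" by (cases s) auto
  have "\<not> d n \<le> 1 - \<epsilon>" using mixing_time_le[of n "1 - \<epsilon>"] n by (auto simp: s_def)
  moreover have "d t \<le> \<epsilon>" unfolding t_def using \<epsilon> by (intro d_mixing_time)
  moreover have "s \<le> t" unfolding s_def t_def using \<epsilon> by (intro mixing_time_antimono) auto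
  moreover from this n have "d n \<le> d t + real (t - n) * (2 * real k / real (Suc n))"
    by (intro d_increments) simp
  ultimately have "1 - 2 * \<epsilon> < (real t - real s + 1) * (2 * real k / real s)"
    using n by (simp add: of_nat_diff algebra_simps)
  then have "(1 - 2 * \<epsilon>) * real s < (real t - real s + 1) * (2 * real k)"
    using n by (simp add: pos_less_divide_eq)
  moreover have "4 * real k \<le> (1 - 2 * \<epsilon>) * real s" using large by (simp add: s_def)
  ultimately have "(1 - 2 * \<epsilon>) * real s \<le> (real t - real s) * (4 * real k)"
    by (simp add: algebra_simps)
  then show ?thesis
    using k_pos by (simp add: field_simps flip: s_def t_def)
qed

end

text \<open>As \<open>k \<le> ln p / ln (ln p)\<close>, the left side is \<open>exp (o (ln p))\<close>.\<close>

lemma eventually_support_small: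
  fixes C \<epsilon> :: real
  assumes "0 < \<epsilon>" "0 < C"
  shows "\<exists>p\<^sub>0 > 2. \<forall>p\<ge>p\<^sub>0. \<forall>k :: nat. real k \<le> ln (real p) / ln (ln (real p)) \<longrightarrow> 2 powr (C * real k) < \<epsilon> * real p"
proof -
  have "eventually (\<lambda>p :: nat. C * ln 2 * (ln (real p) / ln (ln (real p))) < ln \<epsilon> + ln (real p)) sequentially"
    using assms by real_asymp
  then have "eventually (\<lambda>p. C * ln 2 * (ln (real p) / ln (ln (real p))) < ln \<epsilon> + ln (real p) \<and> 2 < p) sequentially"
    by (intro eventually_conj eventually_gt_at_top)
  then obtain p\<^sub>0 where p\<^sub>0: "\<And>p. p \<ge> p\<^sub>0 \<Longrightarrow> C * ln 2 * (ln (real p) / ln (ln (real p))) < ln \<epsilon> + ln (real p) \<and> 2 < p"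
    unfolding eventually_sequentially by blast
  show ?thesis
  proof (intro exI[of _ p\<^sub>0] conjI allI impI)
    show "2 < p\<^sub>0" using p\<^sub>0[of p\<^sub>0] by simp
    fix p k :: nat assume p: "p\<^sub>0 \<le> p" and k: "real k \<le> ln (real p) / ln (ln (real p))"
    have "C * ln 2 * real k \<le> C * ln 2 * (ln (real p) / ln (ln (real p)))"
      using assms k by (intro mult_left_mono) auto
    also have "\<dots> < ln \<epsilon> + ln (real p)" using p\<^sub>0[OF p] by blast
    also have "\<dots> = ln (\<epsilon> * real p)" using assms p\<^sub>0[OF p] by (simp add: ln_mult)
    finally have "exp (C * ln 2 * real k) < exp (ln (\<epsilon> * real p))"
      by (simp only: exp_less_cancel_iff)
    also have "\<dots> = \<epsilon> * real p"
      using assms p\<^sub>0[OF p] by (intro exp_ln) simp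
    finally have "exp (C * ln 2 * real k) < \<epsilon> * real p" .
    then show "2 powr (C * real k) < \<epsilon> * real p"
      by (simp add: powr_def mult_ac)
  qed
qed

theorem theorem3:
  fixes \<epsilon> :: real
  assumes "0 < \<epsilon>" and "\<epsilon> < 1 / exp 1"
  shows "\<exists>c > 0. \<exists>p\<^sub>0 :: nat. \<forall>p :: nat. prime p \<longrightarrow> p \<ge> p\<^sub>0 \<longrightarrow>
           (\<forall>k :: nat. 1 \<le> k \<longrightarrow> real k \<le> ln (real p) / ln (ln (real p)) \<longrightarrow>
             (\<forall>A \<in> sym_lazy_sets p k.
                real (mixing_time p A \<epsilon>) - real (mixing_time p A (1 - \<epsilon>))
                  \<ge> c * (real (mixing_time p A (1 / exp 1)) / real k)))"
proof -
  have "1 / exp 1 \<le> (1 / 2 :: real)"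
    using exp_ge_add_one_self[of "1::real"] by (simp add: field_simps)
  then have \<epsilon>: "\<epsilon> < 1 / 2" using assms by linarith
  define \<delta> where "\<delta> = 1 - 2 * \<epsilon>"
  have \<delta>: "0 < \<delta>" "\<delta> < 1" using \<epsilon> assms by (auto simp: \<delta>_def)
  obtain p\<^sub>0 :: nat where p\<^sub>0: "2 < p\<^sub>0"
    "\<And>p k. p\<^sub>0 \<le> p \<Longrightarrow> real k \<le> ln (real p) / ln (ln (real p)) \<Longrightarrow> 2 powr ((4 / \<delta> + 2) * real k) < \<epsilon> * real p"
    using eventually_support_small[of \<epsilon> "4 / \<delta> + 2"] assms \<delta> by (auto simp: add_pos_pos)
  show ?thesis
  proof (intro exI[of _ "\<delta> / 8"] exI[of _ p\<^sub>0] conjI allI impI ballI)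
    show "0 < \<delta> / 8" using \<delta> by simp
    fix p k A
    assume prem: "prime p" "p\<^sub>0 \<le> p" "1 \<le> k" "real k \<le> ln (real p) / ln (ln (real p))"
      "A \<in> sym_lazy_sets p k"
    then interpret cycle_walk p k A
      using p\<^sub>0(1) by unfold_locales auto
    define s where "s = real (mixing_time p A (1 - \<epsilon>))"
    define t where "t = real (mixing_time p A \<epsilon>)"
    define T where "T = real (mixing_time p A (1 / exp 1))"
    \<comment> \<open>Otherwise the support is too small for the walk to be within \<open>1 - \<epsilon>\<close> of uniform at time \<open>s\<close>.\<close>
    have "4 * real k \<le> \<delta> * s"
    proof (rule ccontr)
      assume "\<not> 4 * real k \<le> \<delta> * s"
      then have "s < 4 / \<delta> * real k" using \<delta> by (simp add: field_simps)
      have "\<epsilon> * real p \<le> 2 ^ (mixing_time p A (1 - \<epsilon>) + 2 * k)"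
        using \<epsilon> by (intro support_lower_bound d_mixing_time) simp
      also have "\<dots> = 2 powr (s + 2 * real k)"
        by (simp add: s_def flip: powr_realpow)
      also have "\<dots> \<le> 2 powr ((4 / \<delta> + 2) * real k)"
        using \<open>s < 4 / \<delta> * real k\<close> by (intro powr_mono) (auto simp: algebra_simps)
      also have "\<dots> < \<epsilon> * real p" using prem by (intro p\<^sub>0)
      finally show False by simp
    qed
    then have window: "t - s \<ge> \<delta> / 4 * (s / real k)"
      using mixing_window[of \<epsilon>] assms \<epsilon> by (simp add: s_def t_def \<delta>_def)
    have T: "T \<le> t"
      unfolding T_def t_def using mixing_time_antimono[of \<epsilon> "1 / exp 1"] assms by simp
    have k: "1 \<le> real k" using prem by simp
    have "\<delta> / 8 * (T / real k) \<le> t - s"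
    proof (cases "T / 2 \<le> s")
      case True
      have "\<delta> / 8 * (T / real k) = \<delta> / 4 * (T / 2 / real k)" by simp
      also have "\<dots> \<le> \<delta> / 4 * (s / real k)"
        using True \<delta> k by (intro mult_left_mono divide_right_mono) auto
      finally show ?thesis using window by linarith
    next
      case False
      have "\<delta> / 8 * (T / real k) \<le> 1 / 2 * (T / 1)"
        using \<delta> k by (intro mult_mono divide_left_mono) (auto simp: T_def)
      then show ?thesis using False T by linarith
    qed
    then show "real (mixing_time p A \<epsilon>) - real (mixing_time p A (1 - \<epsilon>))
        \<ge> \<delta> / 8 * (real (mixing_time p A (1 / exp 1)) / real k)"
      by (simp add: s_def t_def T_def)
  qed
qed

end
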